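(* Let $G$ be a finite simple graph. If $G$ is Sidorenko, then for every integer $m \ge 2$ the $m$-fold blow-up of $G$ is forcing.
   Context: All graphs are finite and simple; $V_G$, $E_G$ denote vertex and edge sets and $e_G=|E_G|$. For graphs $G,H$, $t(G,H)$ is the probability that a uniformly random map $\phi:V_G\to V_H$ is a graph homomorphism, i.e. $\{\phi(u),\phi(v)\}\in E_H$ for every $\{u,v\}\in E_G$. $K_2$ is a single edge. A graph $G$ is Sidorenko if $t(G,H)\ge t(K_2,H)^{e_G}$ for every graph $H$. A sequence of graphs $(H_n)_{n\in\mathbb N}$ of increasing order (number of vertices) is $p$-quasi-random if $t(J,H_n)=(1+o(1))\,p^{e_J}$ for every graph $J$. A graph $G$ is forcing if, for every $p\in[0,1]$, every sequence $(H_n)_{n\in\mathbb N}$ of graphs of increasing order with $t(K_2,H_n)=(1+o(1))\,p$ and $t(G,H_n)=(1+o(1))\,p^{e_G}$ is $p$-quasi-random. The $m$-fold blow-up of $G$ is the graph on vertex set $V_G\times[m]$, $[m]=\{1,\dots,m\}$, in which $(v,i)$ and $(w,j)$ are adjacent if and only if $v$ and $w$ are adjacent in $G$.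
   Formalization: The graph G is assumed to have at least one edge; for edgeless G the claim fails, since G is trivially Sidorenko but its edgeless blow-up is not forcing (e.g. K_{n,n} with p = 1/2 contains no triangles). *)

theory Defs
  imports Complex_Main "HOL-Library.FuncSet" "HOL-Library.Landau_Symbols"
begin

record 'a sgraph =
  verts :: "'a set"
  edges :: "'a set set"

definition finite_simple_graph :: "'a sgraph \<Rightarrow> bool" where
  "finite_simple_graph G \<longleftrightarrow>
     finite (verts G) \<and> edges G \<subseteq> {e. e \<subseteq> verts G \<and> card e = 2}"

definition K2 :: "nat sgraph" where
  "K2 = \<lparr>verts = {0, 1}, edges = {{0, 1}}\<rparr>"

text \<open>
  Maps \<open>V\<^sub>G \<rightarrow> V\<^sub>H\<close> are extensional functions, so that there are exactly
  \<open>|V\<^sub>H| ^ |V\<^sub>G|\<close> of them.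
\<close>

definition graph_homs :: "'a sgraph \<Rightarrow> 'b sgraph \<Rightarrow> ('a \<Rightarrow> 'b) set" where
  "graph_homs G H =
     {\<phi> \<in> verts G \<rightarrow>\<^sub>E verts H. \<forall>u v. {u, v} \<in> edges G \<longrightarrow> {\<phi> u, \<phi> v} \<in> edges H}"

definition hom_density :: "'a sgraph \<Rightarrow> 'b sgraph \<Rightarrow> real" where
  "hom_density G H = real (card (graph_homs G H)) / real (card (verts G \<rightarrow>\<^sub>E verts H))"

text \<open>
  Quantification over all finite graphs is rendered as quantification over the finite graphs
  with vertices in \<^typ>\<open>nat\<close>, which represent all isomorphism types; the lemmas at the end
  transfer the definitions to graphs over arbitrary vertex types. Host graphs are nonempty,
  since otherwise there is no random map into them.
\<close>

definition sidorenko :: "'a sgraph \<Rightarrow> bool" where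
  "sidorenko G \<longleftrightarrow>
     (\<forall>H :: nat sgraph. finite_simple_graph H \<and> verts H \<noteq> {} \<longrightarrow>
        hom_density G H \<ge> hom_density K2 H ^ card (edges G))"

definition increasing_graph_seq :: "(nat \<Rightarrow> 'b sgraph) \<Rightarrow> bool" where
  "increasing_graph_seq H \<longleftrightarrow>
     (\<forall>n. finite_simple_graph (H n) \<and> verts (H n) \<noteq> {}) \<and>
     strict_mono (\<lambda>n. card (verts (H n)))"

text \<open>
  The relation \<open>f = (1 + o(1)) g\<close> is asymptotic equivalence; for \<open>g = 0\<close> it says that \<open>f\<close> is
  eventually \<open>0\<close>.
\<close>

definition quasi_random :: "real \<Rightarrow> (nat \<Rightarrow> 'b sgraph) \<Rightarrow> bool" where
  "quasi_random p H \<longleftrightarrow>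
     increasing_graph_seq H \<and>
     (\<forall>J :: nat sgraph. finite_simple_graph J \<longrightarrow>
        (\<lambda>n. hom_density J (H n)) \<sim>[sequentially] (\<lambda>n. p ^ card (edges J)))"

definition forcing :: "'a sgraph \<Rightarrow> bool" where
  "forcing G \<longleftrightarrow>
     (\<forall>p \<in> {0..1}. \<forall>H :: nat \<Rightarrow> nat sgraph.
        increasing_graph_seq H \<and>
        (\<lambda>n. hom_density K2 (H n)) \<sim>[sequentially] (\<lambda>n. p) \<and>
        (\<lambda>n. hom_density G (H n)) \<sim>[sequentially] (\<lambda>n. p ^ card (edges G)) \<longrightarrow>
        quasi_random p H)"

definition blow_up :: "nat \<Rightarrow> 'a sgraph \<Rightarrow> ('a \<times> nat) sgraph" where
  "blow_up m G =
     \<lparr>verts = verts G \<times> {1..m},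
      edges = {{(v, i), (w, j)} | v w i j. {v, w} \<in> edges G \<and> i \<in> {1..m} \<and> j \<in> {1..m}}\<rparr>"

lemma finite_simple_graph_blow_up:
  assumes "finite_simple_graph G"
  shows "finite_simple_graph (blow_up m G)"
proof -
  have edge: "v \<in> verts G \<and> w \<in> verts G \<and> v \<noteq> w" if "{v, w} \<in> edges G" for v w
  proof -
    have "{v, w} \<subseteq> verts G" "card {v, w} = 2"
      using assms that unfolding finite_simple_graph_def by blast+
    then show ?thesis by (cases "v = w") auto
  qed
  have "e \<subseteq> verts (blow_up m G) \<and> card e = 2" if e: "e \<in> edges (blow_up m G)" for e
  proof -
    obtain v w i j where e: "e = {(v, i), (w, j)}" and vw: "{v, w} \<in> edges G"
      and ij: "i \<in> {1..m}" "j \<in> {1..m}"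
      using e unfolding blow_up_def by auto
    show ?thesis using edge[OF vw] ij by (simp add: e blow_up_def)
  qed
  moreover have "finite (verts (blow_up m G))"
    using assms by (simp add: finite_simple_graph_def blow_up_def)
  ultimately show ?thesis unfolding finite_simple_graph_def by blast
qed

definition relabel :: "('a \<Rightarrow> 'b) \<Rightarrow> 'a sgraph \<Rightarrow> 'b sgraph" where
  "relabel f G = \<lparr>verts = f ` verts G, edges = (`) f ` edges G\<rparr>"

lemma finite_simple_graph_relabel:
  assumes "finite_simple_graph G" "inj_on f (verts G)"
  shows "finite_simple_graph (relabel f G)"
proof -
  have "card (f ` e) = 2" if "e \<in> edges G" for e
  proof -
    have "e \<subseteq> verts G" "card e = 2"
      using assms(1) that unfolding finite_simple_graph_def by blast+
    then show ?thesis
      using assms(2) by (simp add: card_image inj_on_subset)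
  qed
  then show ?thesis
    using assms by (auto simp: finite_simple_graph_def relabel_def)
qed

lemma card_verts_relabel:
  "inj_on f (verts G) \<Longrightarrow> card (verts (relabel f G)) = card (verts G)"
  by (simp add: relabel_def card_image)

lemma card_edges_relabel:
  assumes "finite_simple_graph G" "inj_on f (verts G)"
  shows "card (edges (relabel f G)) = card (edges G)"
proof -
  have "edges G \<subseteq> Pow (verts G)"
    using assms by (auto simp: finite_simple_graph_def)
  then have "inj_on ((`) f) (edges G)"
    using assms(2) by (meson inj_on_image_Pow inj_on_subset)
  then show ?thesis by (simp add: relabel_def card_image)
qed

lemma edge_relabel_iff:
  assumes "finite_simple_graph G" "inj_on f (verts G)" "u \<in> verts G" "v \<in> verts G"
  shows "{f u, f v} \<in> edges (relabel f G) \<longleftrightarrow> {u, v} \<in> edges G"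
proof
  assume "{f u, f v} \<in> edges (relabel f G)"
  then obtain e where e: "e \<in> edges G" "f ` {u, v} = f ` e"
    by (auto simp: relabel_def)
  moreover have "e \<subseteq> verts G" using assms(1) e(1) by (auto simp: finite_simple_graph_def)
  ultimately have "{u, v} = e"
    using assms by (metis empty_subsetI inj_on_image_eq_iff insert_subset)
  then show "{u, v} \<in> edges G" using e by simp
next
  assume "{u, v} \<in> edges G"
  then have "f ` {u, v} \<in> (`) f ` edges G" by (rule imageI)
  then show "{f u, f v} \<in> edges (relabel f G)" by (simp add: relabel_def)
qed

lemma edge_vertsD:
  "finite_simple_graph G \<Longrightarrow> {u, v} \<in> edges G \<Longrightarrow> u \<in> verts G \<and> v \<in> verts G"
  by (auto simp: finite_simple_graph_def)

lemma hom_density_relabel_target: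
  assumes G: "finite_simple_graph G" and H: "finite_simple_graph H"
    and f: "inj_on f (verts H)"
  shows "hom_density G (relabel f H) = hom_density G H"
proof -
  define F where "F \<phi> = restrict (f \<circ> \<phi>) (verts G)" for \<phi> :: "'a \<Rightarrow> 'b"
  have bij: "bij_betw F (verts G \<rightarrow>\<^sub>E verts H) (verts G \<rightarrow>\<^sub>E verts (relabel f H))"
  proof (rule bij_betwI[where g = "\<lambda>\<psi>. restrict (inv_into (verts H) f \<circ> \<psi>) (verts G)"])
    show "F \<in> (verts G \<rightarrow>\<^sub>E verts H) \<rightarrow> (verts G \<rightarrow>\<^sub>E verts (relabel f H))"
      by (auto simp: F_def relabel_def)
    show "(\<lambda>\<psi>. restrict (inv_into (verts H) f \<circ> \<psi>) (verts G))
        \<in> (verts G \<rightarrow>\<^sub>E verts (relabel f H)) \<rightarrow> (verts G \<rightarrow>\<^sub>E verts H)"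
      using f by (force simp: relabel_def PiE_iff intro: inv_into_into)
    show "restrict (inv_into (verts H) f \<circ> F \<phi>) (verts G) = \<phi>"
      if "\<phi> \<in> verts G \<rightarrow>\<^sub>E verts H" for \<phi>
      using f that by (auto simp: F_def fun_eq_iff PiE_iff extensional_def restrict_def)
    show "F (restrict (inv_into (verts H) f \<circ> \<psi>) (verts G)) = \<psi>"
      if "\<psi> \<in> verts G \<rightarrow>\<^sub>E verts (relabel f H)" for \<psi>
      using that
      by (auto simp: F_def fun_eq_iff PiE_iff extensional_def restrict_def relabel_def f_inv_into_f)
  qed
  have iff: "F \<phi> \<in> graph_homs G (relabel f H) \<longleftrightarrow> \<phi> \<in> graph_homs G H"
    if \<phi>: "\<phi> \<in> verts G \<rightarrow>\<^sub>E verts H" for \<phi>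
  proof -
    have "F \<phi> \<in> verts G \<rightarrow>\<^sub>E verts (relabel f H)" using bij \<phi> by (rule bij_betw_apply)
    moreover have "{F \<phi> u, F \<phi> v} \<in> edges (relabel f H) \<longleftrightarrow> {\<phi> u, \<phi> v} \<in> edges H"
      if "{u, v} \<in> edges G" for u v
    proof -
      have uv: "u \<in> verts G" "v \<in> verts G" using edge_vertsD[OF G that] by auto
      then have "\<phi> u \<in> verts H" "\<phi> v \<in> verts H" using \<phi> by auto
      from edge_relabel_iff[OF H f this] show ?thesis using uv by (simp add: F_def)
    qed
    ultimately show ?thesis using \<phi> by (auto simp: graph_homs_def)
  qed
  have "bij_betw F (graph_homs G H) (graph_homs G (relabel f H))"
    unfolding bij_betw_def
  proof
    show "inj_on F (graph_homs G H)"
      using bij_betw_imp_inj_on[OF bij] by (rule inj_on_subset) (auto simp: graph_homs_def)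
    show "F ` graph_homs G H = graph_homs G (relabel f H)"
    proof (intro equalityI subsetI)
      fix \<psi> assume "\<psi> \<in> F ` graph_homs G H"
      then show "\<psi> \<in> graph_homs G (relabel f H)"
        using iff by (auto simp: graph_homs_def)
    next
      fix \<psi> assume \<psi>: "\<psi> \<in> graph_homs G (relabel f H)"
      then have "\<psi> \<in> verts G \<rightarrow>\<^sub>E verts (relabel f H)" by (simp add: graph_homs_def)
      then obtain \<phi> where "\<phi> \<in> verts G \<rightarrow>\<^sub>E verts H" "\<psi> = F \<phi>"
        using bij_betw_imp_surj_on[OF bij] by blast
      then show "\<psi> \<in> F ` graph_homs G H" using iff \<psi> by blast
    qed
  qed
  then show ?thesis
    using bij by (simp add: hom_density_def bij_betw_same_card)
qed

lemma hom_density_relabel_source: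
  assumes G: "finite_simple_graph G" and f: "inj_on f (verts G)"
  shows "hom_density (relabel f G) H = hom_density G H"
proof -
  define F where "F \<psi> = restrict (\<psi> \<circ> f) (verts G)" for \<psi> :: "'b \<Rightarrow> 'c"
  have bij: "bij_betw F (verts (relabel f G) \<rightarrow>\<^sub>E verts H) (verts G \<rightarrow>\<^sub>E verts H)"
  proof (rule bij_betwI[where g = "\<lambda>\<phi>. restrict (\<phi> \<circ> inv_into (verts G) f) (f ` verts G)"])
    show "F \<in> (verts (relabel f G) \<rightarrow>\<^sub>E verts H) \<rightarrow> (verts G \<rightarrow>\<^sub>E verts H)"
      by (auto simp: F_def relabel_def)
    show "(\<lambda>\<phi>. restrict (\<phi> \<circ> inv_into (verts G) f) (f ` verts G))
        \<in> (verts G \<rightarrow>\<^sub>E verts H) \<rightarrow> (verts (relabel f G) \<rightarrow>\<^sub>E verts H)"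
      using f by (auto simp: relabel_def)
    show "restrict (F \<psi> \<circ> inv_into (verts G) f) (f ` verts G) = \<psi>"
      if "\<psi> \<in> verts (relabel f G) \<rightarrow>\<^sub>E verts H" for \<psi>
      using f that
      by (auto simp: F_def fun_eq_iff PiE_iff extensional_def restrict_def relabel_def)
    show "F (restrict (\<phi> \<circ> inv_into (verts G) f) (f ` verts G)) = \<phi>"
      if "\<phi> \<in> verts G \<rightarrow>\<^sub>E verts H" for \<phi>
      using f that by (auto simp: F_def fun_eq_iff PiE_iff extensional_def restrict_def)
  qed
  have iff: "F \<psi> \<in> graph_homs G H \<longleftrightarrow> \<psi> \<in> graph_homs (relabel f G) H"
    if \<psi>: "\<psi> \<in> verts (relabel f G) \<rightarrow>\<^sub>E verts H" for \<psi>
  proof -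
    have "F \<psi> \<in> verts G \<rightarrow>\<^sub>E verts H" using bij \<psi> by (rule bij_betw_apply)
    moreover have "(\<forall>u v. {u, v} \<in> edges G \<longrightarrow> {F \<psi> u, F \<psi> v} \<in> edges H) \<longleftrightarrow>
        (\<forall>x y. {x, y} \<in> edges (relabel f G) \<longrightarrow> {\<psi> x, \<psi> y} \<in> edges H)" (is "?A \<longleftrightarrow> ?B")
    proof
      assume A: ?A
      show ?B
      proof (intro allI impI)
        fix x y assume xy: "{x, y} \<in> edges (relabel f G)"
        then have "x \<in> f ` verts G \<and> y \<in> f ` verts G"
          using edge_vertsD[OF finite_simple_graph_relabel[OF G f] xy] by (simp add: relabel_def)
        then obtain u v where uv: "u \<in> verts G" "v \<in> verts G" "x = f u" "y = f v" by auto
        then show "{\<psi> x, \<psi> y} \<in> edges H"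
          using A xy edge_relabel_iff[OF G f uv(1,2)] by (force simp: F_def)
      qed
    next
      assume B: ?B
      show ?A
      proof (intro allI impI)
        fix u v assume uv: "{u, v} \<in> edges G"
        then have "u \<in> verts G" "v \<in> verts G" using edge_vertsD[OF G] by auto
        then show "{F \<psi> u, F \<psi> v} \<in> edges H"
          using B uv edge_relabel_iff[OF G f] by (simp add: F_def)
      qed
    qed
    ultimately show ?thesis using \<psi> by (simp add: graph_homs_def)
  qed
  have "bij_betw F (graph_homs (relabel f G) H) (graph_homs G H)"
    unfolding bij_betw_def
  proof
    show "inj_on F (graph_homs (relabel f G) H)"
      using bij_betw_imp_inj_on[OF bij] by (rule inj_on_subset) (auto simp: graph_homs_def)
    show "F ` graph_homs (relabel f G) H = graph_homs G H"
    proof (intro equalityI subsetI)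
      fix \<phi> assume "\<phi> \<in> F ` graph_homs (relabel f G) H"
      then show "\<phi> \<in> graph_homs G H"
        using iff by (auto simp: graph_homs_def)
    next
      fix \<phi> assume \<phi>: "\<phi> \<in> graph_homs G H"
      then have "\<phi> \<in> verts G \<rightarrow>\<^sub>E verts H" by (simp add: graph_homs_def)
      then obtain \<psi> where "\<psi> \<in> verts (relabel f G) \<rightarrow>\<^sub>E verts H" "\<phi> = F \<psi>"
        using bij_betw_imp_surj_on[OF bij] by blast
      then show "\<phi> \<in> F ` graph_homs (relabel f G) H" using iff \<phi> by blast
    qed
  qed
  then show ?thesis
    using bij by (simp add: hom_density_def bij_betw_same_card)
qed

lemma ex_nat_labelling:
  assumes "finite_simple_graph G"
  shows "\<exists>f :: 'a \<Rightarrow> nat. inj_on f (verts (G :: 'a sgraph))"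
  using assms finite_imp_inj_to_nat_seg[of "verts G"]
  unfolding finite_simple_graph_def by blast

lemma finite_simple_graph_K2: "finite_simple_graph K2"
  by (auto simp: finite_simple_graph_def K2_def)

lemma sidorenkoD:
  fixes H :: "'b sgraph"
  assumes "sidorenko G" "finite_simple_graph G" "finite_simple_graph H" "verts H \<noteq> {}"
  shows "hom_density G H \<ge> hom_density K2 H ^ card (edges G)"
proof -
  obtain f :: "'b \<Rightarrow> nat" where f: "inj_on f (verts H)"
    using ex_nat_labelling[OF assms(3)] by blast
  have "hom_density G (relabel f H) \<ge> hom_density K2 (relabel f H) ^ card (edges G)"
    using assms(1,4) finite_simple_graph_relabel[OF assms(3) f]
    by (simp add: sidorenko_def relabel_def)
  then show ?thesis
    using assms f by (simp add: hom_density_relabel_target finite_simple_graph_K2)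
qed

lemma quasi_randomD:
  fixes J :: "'a sgraph"
  assumes "quasi_random p H" "finite_simple_graph J"
  shows "(\<lambda>n. hom_density J (H n)) \<sim>[sequentially] (\<lambda>n. p ^ card (edges J))"
proof -
  obtain f :: "'a \<Rightarrow> nat" where f: "inj_on f (verts J)"
    using ex_nat_labelling[OF assms(2)] by blast
  have "(\<lambda>n. hom_density (relabel f J) (H n)) \<sim>[sequentially] (\<lambda>n. p ^ card (edges (relabel f J)))"
    using assms(1) finite_simple_graph_relabel[OF assms(2) f] by (simp add: quasi_random_def)
  then show ?thesis
    using assms(2) f by (simp add: hom_density_relabel_source card_edges_relabel)
qed

lemma forcingD:
  fixes H :: "nat \<Rightarrow> 'b sgraph"
  assumes "forcing G" "finite_simple_graph G" "p \<in> {0..1}" "increasing_graph_seq H"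
    and "(\<lambda>n. hom_density K2 (H n)) \<sim>[sequentially] (\<lambda>n. p)"
    and "(\<lambda>n. hom_density G (H n)) \<sim>[sequentially] (\<lambda>n. p ^ card (edges G))"
  shows "quasi_random p H"
proof -
  have H: "finite_simple_graph (H n)" for n
    using assms(4) by (simp add: increasing_graph_seq_def)
  obtain f :: "nat \<Rightarrow> 'b \<Rightarrow> nat" where f: "\<And>n. inj_on (f n) (verts (H n))"
    using ex_nat_labelling[OF H] by metis
  define H' where "H' n = relabel (f n) (H n)" for n
  have dens_nat: "hom_density J (H' n) = hom_density J (H n)" if "finite_simple_graph J"
    for J :: "nat sgraph" and n
    unfolding H'_def using that H f by (rule hom_density_relabel_target)
  have densG: "hom_density G (H' n) = hom_density G (H n)" for n
    unfolding H'_def using assms(2) H f by (rule hom_density_relabel_target)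
  have "card (verts (H' n)) = card (verts (H n))" for n
    unfolding H'_def using f by (rule card_verts_relabel)
  moreover have "finite_simple_graph (H' n)" for n
    unfolding H'_def using H f by (rule finite_simple_graph_relabel)
  ultimately have "increasing_graph_seq H'"
    using assms(4) by (simp add: increasing_graph_seq_def) (simp add: H'_def relabel_def)
  then have "quasi_random p H'"
    using assms(1,3,5,6) dens_nat[OF finite_simple_graph_K2] densG by (simp add: forcing_def)
  then show ?thesis
    using assms(4) dens_nat by (simp add: quasi_random_def)
qed

end

theory Submission
  imports Defs
begin

text \<open>
  Let \<open>H\<^sup>(\<^sup>m\<^sup>)\<close> be the graph on \<open>V\<^sub>H\<^sup>m\<close> in which \<open>x\<close> and \<open>y\<close> are adjacent iff all \<open>x\<^sub>i y\<^sub>j\<close> are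
  edges of \<open>H\<close>. Then \<open>t(G(m), H) = t(G, H\<^sup>(\<^sup>m\<^sup>))\<close>, and since \<open>G\<close> is Sidorenko this is at least
  \<open>t(K\<^sub>2, H\<^sup>(\<^sup>m\<^sup>))\<close> to the power \<open>e\<^sub>G\<close>, where \<open>t(K\<^sub>2, H\<^sup>(\<^sup>m\<^sup>))\<close> is the density of the complete bipartite graph
  \<open>K\<^sub>m\<^sub>,\<^sub>m\<close> in \<open>H\<close>. Two applications of the power mean inequality bound the latter below by
  \<open>q\<close> to the power \<open>m\<^sup>2\<close>, with \<open>q = t(C\<^sub>4, H)\<^sup>1\<^sup>/\<^sup>4 \<ge> t(K\<^sub>2, H)\<close>. So the hypotheses squeeze \<open>t(C\<^sub>4, H\<^sub>n)\<close> to \<open>p\<^sup>4\<close>.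
  Then the codegrees of \<open>H\<^sub>n\<close> recentred by \<open>p\<close> tend to \<open>0\<close> in mean square, which by Cauchy-Schwarz
  lets one replace the edges of any \<open>J\<close> one after the other by the constant \<open>p\<close>.
\<close>

section \<open>Averages over finite sets\<close>

text \<open>Division by zero makes this 0 on empty and on infinite \<open>S\<close>, so linearity,
  monotonicity and exchange of averages carry no finiteness conditions.\<close>

definition avg :: "'a set \<Rightarrow> ('a \<Rightarrow> real) \<Rightarrow> real" where
  "avg S f = (\<Sum>x\<in>S. f x) / real (card S)"

lemma avg_cong: "S = T \<Longrightarrow> (\<And>x. x \<in> T \<Longrightarrow> f x = g x) \<Longrightarrow> avg S f = avg T g"
  by (simp add: avg_def cong: sum.cong)

lemma avg_const: "finite S \<Longrightarrow> S \<noteq> {} \<Longrightarrow> avg S (\<lambda>_. c) = c"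
  by (simp add: avg_def)

lemma avg_add: "avg S (\<lambda>x. f x + g x) = avg S f + avg S g"
  by (simp add: avg_def sum.distrib add_divide_distrib)

lemma avg_diff: "avg S (\<lambda>x. f x - g x) = avg S f - avg S g"
  by (simp add: avg_def sum_subtractf diff_divide_distrib)

lemma avg_cmult: "avg S (\<lambda>x. c * f x) = c * avg S f"
  by (simp add: avg_def sum_distrib_left)

lemma avg_mono: "(\<And>x. x \<in> S \<Longrightarrow> f x \<le> g x) \<Longrightarrow> avg S f \<le> avg S g"
  by (simp add: avg_def sum_mono divide_right_mono)

lemma avg_nonneg: "(\<And>x. x \<in> S \<Longrightarrow> 0 \<le> f x) \<Longrightarrow> 0 \<le> avg S f"
  by (simp add: avg_def sum_nonneg)

lemma avg_swap: "avg A (\<lambda>a. avg B (f a)) = avg B (\<lambda>b. avg A (\<lambda>a. f a b))"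
  by (simp add: avg_def sum_divide_distrib[symmetric] mult.commute sum.swap[where A = A])

lemma avg_rotate:
  "avg A (\<lambda>a. avg B (\<lambda>b. avg C (f a b))) = avg B (\<lambda>b. avg C (\<lambda>c. avg A (\<lambda>a. f a b c)))"
  by (subst avg_swap) (intro avg_cong refl avg_swap)

lemma avg_mult: "avg A f * avg B g = avg A (\<lambda>a. avg B (\<lambda>b. f a * g b))"
  by (simp add: avg_def sum_divide_distrib[symmetric] sum_product)

lemma avg_Times: "avg A (\<lambda>a. avg B (f a)) = avg (A \<times> B) (\<lambda>(a, b). f a b)"
  by (simp add: avg_def sum_divide_distrib[symmetric] sum.cartesian_product card_cartesian_product
      mult.commute)

lemma avg_abs_le:
  assumes "finite S" "S \<noteq> {}" "\<And>x. x \<in> S \<Longrightarrow> \<bar>f x\<bar> \<le> c"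
  shows "\<bar>avg S f\<bar> \<le> c"
proof -
  have "avg S f \<le> avg S (\<lambda>_. c)" "avg S (\<lambda>_. -c) \<le> avg S f"
    using assms(3) by (intro avg_mono; force)+
  then show ?thesis using assms by (simp add: avg_const)
qed

lemma avg_reindex: "bij_betw h A B \<Longrightarrow> avg B f = avg A (\<lambda>x. f (h x))"
  by (simp add: avg_def bij_betw_same_card sum.reindex_bij_betw[symmetric])

text \<open>The values of a uniformly random map are independent and uniform on \<open>N\<close>, so
  the average of the product factorises.\<close>

lemma avg_PiE_prod:
  assumes "finite I" "finite N"
  shows "avg (I \<rightarrow>\<^sub>E N) (\<lambda>x. \<Prod>i\<in>I. f (x i)) = avg N f ^ card I"
  using assms prod_sum_PiE[of I "\<lambda>_. N" "\<lambda>_. f"]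
  by (simp add: avg_def card_PiE power_divide)

text \<open>The tangent line at \<open>s\<^sup>2\<close> of the convex function \<open>y \<mapsto> y\<^bsup>(k+2)/2\<^esup>\<close>, evaluated at \<open>y = x\<^sup>2\<close>.\<close>

lemma power_tangent:
  fixes x s :: real
  assumes "0 \<le> x" "0 \<le> s"
  shows "(real k + 2) * x\<^sup>2 * s ^ k \<le> 2 * x ^ (k + 2) + real k * s ^ (k + 2)"
proof (induction k)
  case (Suc k)
  \<comment> \<open>The gap for \<open>Suc k\<close> is \<open>x\<close> times the gap for
    \<open>k\<close> plus a nonnegative multiple of the square of \<open>x - s\<close>; for
    \<open>k = 0\<close> the gap is 0.\<close>
  have "2 * x ^ (Suc k + 2) + real (Suc k) * s ^ (Suc k + 2) - (real (Suc k) + 2) * x\<^sup>2 * s ^ Suc k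
      = x * (2 * x ^ (k + 2) + real k * s ^ (k + 2) - (real k + 2) * x\<^sup>2 * s ^ k)
        + s ^ k * ((x - s)\<^sup>2 * ((real k + 2) * x + (real k + 1) * s))"
    by (simp add: algebra_simps power2_eq_square)
  also have "\<dots> \<ge> 0"
    using Suc assms by (intro add_nonneg_nonneg mult_nonneg_nonneg) auto
  finally show ?case by simp
qed (simp add: power2_eq_square)

text \<open>Power mean inequality for exponents 2 and \<open>m\<close>. It is the average over
  \<open>S\<close> of the tangent bound whose point of contact \<open>s\<close> is the root mean
  square of \<open>f\<close>.\<close>

lemma avg_power_ge:
  assumes S: "finite S" "S \<noteq> {}" and f: "\<And>x. x \<in> S \<Longrightarrow> 0 \<le> f x" and m: "m \<ge> 2"
  shows "sqrt (avg S (\<lambda>x. (f x)\<^sup>2)) ^ m \<le> avg S (\<lambda>x. f x ^ m)"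
proof -
  obtain k where k: "m = k + 2" using m by (metis add.commute le_Suc_ex)
  define s where "s = sqrt (avg S (\<lambda>x. (f x)\<^sup>2))"
  have s: "s\<^sup>2 = avg S (\<lambda>x. (f x)\<^sup>2)" "0 \<le> s"
    by (simp_all add: s_def avg_nonneg)
  have "avg S (\<lambda>x. ((real k + 2) * s ^ k) * (f x)\<^sup>2)
      \<le> avg S (\<lambda>x. 2 * f x ^ (k + 2) + real k * s ^ (k + 2))"
    using power_tangent[OF f s(2), of _ k] by (intro avg_mono) (simp add: mult_ac)
  then have "((real k + 2) * s ^ k) * s\<^sup>2 \<le> 2 * avg S (\<lambda>x. f x ^ (k + 2)) + real k * s ^ (k + 2)"
    unfolding avg_cmult avg_add avg_const[OF S] s(1) .
  then have "s ^ (k + 2) \<le> avg S (\<lambda>x. f x ^ (k + 2))"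
    by (simp add: power2_eq_square algebra_simps)
  then show ?thesis by (simp add: k s_def)
qed

text \<open>The variance of \<open>f\<close> is nonnegative.\<close>

lemma avg_square_ge:
  assumes "finite S" "S \<noteq> {}"
  shows "(avg S f)\<^sup>2 \<le> avg S (\<lambda>x. (f x)\<^sup>2)"
proof -
  define c where "c = avg S f"
  have "0 \<le> avg S (\<lambda>x. (f x - c)\<^sup>2)" by (simp add: avg_nonneg)
  also have "(\<lambda>x. (f x - c)\<^sup>2) = (\<lambda>x. (f x)\<^sup>2 - (2 * c) * f x + c\<^sup>2)"
    by (auto simp: power2_eq_square algebra_simps)
  also have "avg S \<dots> = avg S (\<lambda>x. (f x)\<^sup>2) - (2 * c) * c + c\<^sup>2"
    using assms by (simp add: avg_add avg_diff avg_cmult avg_const c_def[symmetric])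
  finally show ?thesis by (simp add: c_def power2_eq_square)
qed

lemma avg_avg_square_ge:
  assumes "finite S" "S \<noteq> {}"
  shows "(avg S (\<lambda>x. avg S (f x)))\<^sup>2 \<le> avg S (\<lambda>x. avg S (\<lambda>y. (f x y)\<^sup>2))"
  using avg_square_ge[of "S \<times> S" "\<lambda>(x, y). f x y"] assms
  by (simp add: avg_Times case_prod_unfold)

lemma avg_PiE_insert:
  assumes "x \<notin> S"
  shows "avg (insert x S \<rightarrow>\<^sub>E N) f = avg (S \<rightarrow>\<^sub>E N) (\<lambda>\<psi>. avg N (\<lambda>a. f (\<psi>(x := a))))"
proof -
  have "bij_betw (\<lambda>(a, \<psi>). \<psi>(x := a)) (N \<times> (S \<rightarrow>\<^sub>E N)) (insert x S \<rightarrow>\<^sub>E N)"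
    using inj_combinator[OF assms, of "\<lambda>_. N"] by (simp add: bij_betw_def PiE_insert_eq)
  then show ?thesis
    by (subst avg_swap) (simp add: avg_reindex avg_Times case_prod_unfold)
qed

section \<open>Codegrees\<close>

text \<open>Here and below \<open>W\<close> is an arbitrary real kernel, so that both
  \<open>adj H\<close> and its recentring \<open>adj H a b - p\<close> are covered.\<close>

definition degr :: "'b set \<Rightarrow> ('b \<Rightarrow> 'b \<Rightarrow> real) \<Rightarrow> 'b \<Rightarrow> real" where
  "degr N W b = avg N (\<lambda>a. W a b)"

definition codeg :: "'b set \<Rightarrow> ('b \<Rightarrow> 'b \<Rightarrow> real) \<Rightarrow> 'b \<Rightarrow> 'b \<Rightarrow> real" where
  "codeg N W b c = avg N (\<lambda>a. W a b * W a c)"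

text \<open>Expanding the square introduces two vertices, each joined to \<open>b\<close> and to
  \<open>c\<close>; for \<open>W = adj H\<close> this is the density of the 4-cycle with
  \<open>b\<close> and \<open>c\<close> opposite.\<close>

definition four_cycle :: "'b set \<Rightarrow> ('b \<Rightarrow> 'b \<Rightarrow> real) \<Rightarrow> real" where
  "four_cycle N W = avg N (\<lambda>b. avg N (\<lambda>c. (codeg N W b c)\<^sup>2))"

lemma four_cycle_nonneg: "0 \<le> four_cycle N W"
  by (simp add: four_cycle_def avg_nonneg)

text \<open>A form of the bound of the cut norm by the four-cycle norm. Cauchy-Schwarz in
  \<open>a\<close> removes \<open>f\<close>; writing out the square duplicates \<open>b\<close> into
  \<open>b\<close>, \<open>c\<close> and turns the average over \<open>a\<close> into a codegree;
  Cauchy-Schwarz in \<open>b\<close>, \<open>c\<close> then removes \<open>g\<close>.\<close>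

lemma bilinear_le_four_cycle:
  assumes N: "finite N" "N \<noteq> {}"
    and f: "\<And>a. a \<in> N \<Longrightarrow> \<bar>f a\<bar> \<le> 1" and g: "\<And>b. b \<in> N \<Longrightarrow> \<bar>g b\<bar> \<le> 1"
  shows "\<bar>avg N (\<lambda>a. avg N (\<lambda>b. U a b * (f a * g b)))\<bar> \<le> root 4 (four_cycle N U)"
proof -
  define h where "h a = avg N (\<lambda>b. g b * U a b)" for a
  define L where "L = avg N (\<lambda>a. f a * h a)"
  have L: "avg N (\<lambda>a. avg N (\<lambda>b. U a b * (f a * g b))) = L"
    unfolding L_def h_def by (simp only: avg_cmult[symmetric] mult_ac)
  have "L\<^sup>2 \<le> avg N (\<lambda>a. (f a * h a)\<^sup>2)"
    unfolding L_def using N by (rule avg_square_ge)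
  also have "\<dots> \<le> avg N (\<lambda>a. (h a)\<^sup>2)"
    using f by (intro avg_mono) (simp add: power_mult_distrib mult_left_le_one_le abs_square_le_1)
  also have "\<dots> = avg N (\<lambda>a. avg N (\<lambda>b. avg N (\<lambda>c. (g b * g c) * (U a b * U a c))))"
    unfolding h_def power2_eq_square avg_mult by (simp only: mult_ac)
  also have "\<dots> = avg N (\<lambda>b. avg N (\<lambda>c. avg N (\<lambda>a. (g b * g c) * (U a b * U a c))))"
    by (rule avg_rotate)
  also have "\<dots> = avg N (\<lambda>b. avg N (\<lambda>c. (g b * g c) * codeg N U b c))"
    by (simp only: avg_cmult codeg_def)
  finally have "(L\<^sup>2)\<^sup>2 \<le> (avg N (\<lambda>b. avg N (\<lambda>c. (g b * g c) * codeg N U b c)))\<^sup>2"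
    by (intro power_mono) auto
  also have "\<dots> \<le> avg N (\<lambda>b. avg N (\<lambda>c. ((g b * g c) * codeg N U b c)\<^sup>2))"
    using N by (rule avg_avg_square_ge)
  also have "\<dots> \<le> four_cycle N U"
    unfolding four_cycle_def using g
    by (intro avg_mono)
      (simp add: power_mult_distrib mult_left_le_one_le abs_square_le_1 mult_le_one)
  finally have "\<bar>L\<bar> ^ 4 \<le> four_cycle N U" by simp
  then have "root 4 (\<bar>L\<bar> ^ 4) \<le> root 4 (four_cycle N U)" by (intro real_root_le_mono) auto
  moreover have "root 4 (\<bar>L\<bar> ^ 4) = \<bar>L\<bar>" by (rule real_root_power_cancel) auto
  ultimately show ?thesis by (simp only: L)
qed

text \<open>Both sides average over walks with two edges, on the left chosen by their endpoints, on
  the right by their middle vertex.\<close>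

lemma avg_codeg:
  "avg N (\<lambda>b. avg N (codeg N W b)) = avg N (\<lambda>a. (avg N (W a))\<^sup>2)"
proof -
  have "avg N (\<lambda>b. avg N (codeg N W b)) = avg N (\<lambda>b. avg N (\<lambda>a. avg N (\<lambda>c. W a b * W a c)))"
    unfolding codeg_def by (subst avg_swap) simp
  also have "\<dots> = avg N (\<lambda>a. avg N (\<lambda>b. avg N (\<lambda>c. W a b * W a c)))"
    by (rule avg_swap)
  finally show ?thesis by (simp add: power2_eq_square avg_mult)
qed

text \<open>Recentring turns codegrees into combinations of the deviations of codegrees from
  \<open>p\<^sup>2\<close> and of degrees from \<open>p\<close>; the two brackets are their mean
  squares. The bound is 0 at the values \<open>p ^ 4\<close>, \<open>p\<close>,
  \<open>p\<^sup>2\<close> of \<open>four_cycle N W\<close>, \<open>D\<close>,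
  \<open>D2\<close>.\<close>

lemma four_cycle_diff_le:
  assumes N: "finite N" "N \<noteq> {}" and sym: "\<And>a b. W a b = W b a"
  defines "D \<equiv> avg N (degr N W)" and "D2 \<equiv> avg N (\<lambda>b. (degr N W b)\<^sup>2)"
  shows "four_cycle N (\<lambda>a b. W a b - p)
    \<le> 3 * ((four_cycle N W - 2 * p\<^sup>2 * D2 + p ^ 4) + 2 * p\<^sup>2 * (D2 - 2 * p * D + p\<^sup>2))"
proof -
  let ?d = "degr N W" and ?c = "codeg N W"
  have cU: "codeg N (\<lambda>a b. W a b - p) b c = (?c b c - p\<^sup>2) - p * (?d b - p) - p * (?d c - p)" for b c
  proof -
    have "codeg N (\<lambda>a b. W a b - p) b c
        = avg N (\<lambda>a. W a b * W a c - p * W a b - p * W a c + p\<^sup>2)"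
      by (simp add: codeg_def algebra_simps power2_eq_square)
    also have "\<dots> = ?c b c - p * ?d b - p * ?d c + p\<^sup>2"
      unfolding avg_add avg_diff avg_cmult avg_const[OF N] by (simp add: codeg_def degr_def)
    finally show ?thesis by (simp add: algebra_simps power2_eq_square)
  qed
  \<comment> \<open>This is the source of the factor 3.\<close>
  have "(x - y - z)\<^sup>2 \<le> 3 * (x\<^sup>2 + y\<^sup>2 + z\<^sup>2)" for x y z :: real
  proof -
    have "3 * (x\<^sup>2 + y\<^sup>2 + z\<^sup>2) - (x - y - z)\<^sup>2 = (x + y)\<^sup>2 + (x + z)\<^sup>2 + (y - z)\<^sup>2"
      by (simp add: power2_eq_square algebra_simps)
    then show ?thesis by (smt (verit) zero_le_power2)
  qed
  then have "four_cycle N (\<lambda>a b. W a b - p)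
      \<le> avg N (\<lambda>b. avg N (\<lambda>c. 3 * ((?c b c - p\<^sup>2)\<^sup>2 + (p * (?d b - p))\<^sup>2 + (p * (?d c - p))\<^sup>2)))"
    unfolding four_cycle_def cU by (intro avg_mono) blast
  also have "\<dots> = 3 * (avg N (\<lambda>b. avg N (\<lambda>c. (?c b c - p\<^sup>2)\<^sup>2))
      + p\<^sup>2 * avg N (\<lambda>b. (?d b - p)\<^sup>2) + p\<^sup>2 * avg N (\<lambda>b. (?d b - p)\<^sup>2))"
    unfolding power_mult_distrib avg_cmult avg_add avg_const[OF N] by simp
  also have "avg N (\<lambda>b. (?d b - p)\<^sup>2) = D2 - 2 * p * D + p\<^sup>2"
  proof -
    have "(\<lambda>b. (?d b - p)\<^sup>2) = (\<lambda>b. (?d b)\<^sup>2 - (2 * p) * ?d b + p\<^sup>2)"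
      by (auto simp: power2_eq_square algebra_simps)
    then show ?thesis
      unfolding D_def D2_def by (simp only: avg_add avg_diff avg_cmult avg_const[OF N])
  qed
  also have "avg N (\<lambda>b. avg N (\<lambda>c. (?c b c - p\<^sup>2)\<^sup>2)) = four_cycle N W - 2 * p\<^sup>2 * D2 + p ^ 4"
  proof -
    have "(?c b c - p\<^sup>2)\<^sup>2 = (?c b c)\<^sup>2 - (2 * p\<^sup>2) * ?c b c + p ^ 4" for b c
      by (simp add: power2_diff power4_eq_xxxx power2_eq_square algebra_simps)
    moreover have "avg N (\<lambda>b. avg N (?c b)) = D2"
      unfolding avg_codeg D2_def degr_def using sym by simp
    ultimately show ?thesis
      by (simp only: avg_add avg_diff avg_cmult avg_const[OF N] four_cycle_def)
  qed
  finally show ?thesis by (simp add: algebra_simps)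
qed

text \<open>The mean squared degree is the mean codegree, whose square is at most the mean squared
  codegree.\<close>

lemma degr_square_le_four_cycle:
  assumes N: "finite N" "N \<noteq> {}" and sym: "\<And>a b. W a b = W b a"
  shows "(avg N (\<lambda>b. (degr N W b)\<^sup>2))\<^sup>2 \<le> four_cycle N W"
proof -
  have "avg N (\<lambda>b. (degr N W b)\<^sup>2) = avg N (\<lambda>b. avg N (codeg N W b))"
    unfolding avg_codeg degr_def using sym by simp
  then show ?thesis using avg_avg_square_ge[OF N, of "codeg N W"] by (simp add: four_cycle_def)
qed

text \<open>The two power mean steps meet in the complete bipartite graph with parts of sizes 2 and
  \<open>card I\<close>, read once as the average of powers of codegrees and once as the mean square
  of \<open>c\<close>.\<close>

lemma complete_bipartite_ge_four_cycle:
  fixes I :: "'i set"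
  assumes N: "finite N" "N \<noteq> {}" and I: "finite I" "card I \<ge> 2"
    and W: "\<And>a b. 0 \<le> W a b"
  shows "root 4 (four_cycle N W) ^ (card I * card I)
    \<le> avg (I \<rightarrow>\<^sub>E N) (\<lambda>x. avg (I \<rightarrow>\<^sub>E N) (\<lambda>y. \<Prod>i\<in>I. \<Prod>j\<in>I. W (x i) (y j)))"
proof -
  let ?m = "card I" and ?X = "I \<rightarrow>\<^sub>E N"
  \<comment> \<open>The codegree of the whole tuple \<open>x\<close>.\<close>
  define c where "c x = avg N (\<lambda>b. \<Prod>i\<in>I. W (x i) b)" for x
  have X: "finite ?X" "?X \<noteq> {}" using N I by (auto simp: finite_PiE PiE_eq_empty_iff)
  have "avg ?X (\<lambda>x. (c x)\<^sup>2)
      = avg ?X (\<lambda>x. avg N (\<lambda>b. avg N (\<lambda>b'. \<Prod>i\<in>I. W (x i) b * W (x i) b')))"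
    unfolding c_def power2_eq_square avg_mult by (simp add: prod.distrib)
  also have "\<dots> = avg N (\<lambda>b. avg N (\<lambda>b'. avg ?X (\<lambda>x. \<Prod>i\<in>I. W (x i) b * W (x i) b')))"
    by (rule avg_rotate)
  \<comment> \<open>For fixed \<open>b\<close>, \<open>b'\<close> the coordinates of
    \<open>x\<close> are independent and each contributes one codegree.\<close>
  also have "\<dots> = avg N (\<lambda>b. avg N (\<lambda>b'. codeg N W b b' ^ ?m))"
    unfolding codeg_def using avg_PiE_prod[OF I(1) N(1), of "\<lambda>a. W a _ * W a _"] by simp
  also have "\<dots> \<ge> sqrt (four_cycle N W) ^ ?m"
    using avg_power_ge[of "N \<times> N" "\<lambda>(b, b'). codeg N W b b'" ?m] N I W
    by (auto simp: avg_Times case_prod_unfold four_cycle_def codeg_def avg_nonneg)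
  finally have "sqrt (sqrt (four_cycle N W) ^ ?m) ^ ?m \<le> sqrt (avg ?X (\<lambda>x. (c x)\<^sup>2)) ^ ?m"
    by (intro power_mono) (simp_all add: four_cycle_nonneg)
  \<comment> \<open>The second power mean step runs over tuples \<open>x\<close>; independence then
    spreads the power of \<open>c x\<close> over the coordinates of \<open>y\<close>.\<close>
  also have "\<dots> \<le> avg ?X (\<lambda>x. c x ^ ?m)"
    using X I W by (intro avg_power_ge) (auto simp: c_def intro!: avg_nonneg prod_nonneg)
  also have "\<dots> = avg ?X (\<lambda>x. avg ?X (\<lambda>y. \<Prod>j\<in>I. \<Prod>i\<in>I. W (x i) (y j)))"
    unfolding c_def using avg_PiE_prod[OF I(1) N(1), of "\<lambda>b. \<Prod>i\<in>I. W (_ i) b"] by simp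
  also have "\<dots> = avg ?X (\<lambda>x. avg ?X (\<lambda>y. \<Prod>i\<in>I. \<Prod>j\<in>I. W (x i) (y j)))"
    by (subst prod.swap) simp
  finally have "sqrt (sqrt (four_cycle N W) ^ ?m) ^ ?m \<le> \<dots>" .
  moreover have "root 4 (four_cycle N W) = sqrt (sqrt (four_cycle N W))"
    using real_root_mult_exp[of 2 2 "four_cycle N W"] by (simp add: sqrt_def)
  ultimately show ?thesis by (simp add: real_sqrt_power power_mult)
qed

section \<open>Homomorphism densities as averages\<close>

definition adj :: "'b sgraph \<Rightarrow> 'b \<Rightarrow> 'b \<Rightarrow> real" where
  "adj H a b = of_bool ({a, b} \<in> edges H)"

lemma adj_commute: "adj H a b = adj H b a"
  by (simp add: adj_def insert_commute)

lemma edgeE: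
  assumes "finite_simple_graph G" "e \<in> edges G"
  obtains u v where "e = {u, v}" "u \<noteq> v" "u \<in> verts G" "v \<in> verts G"
proof -
  have "e \<subseteq> verts G" "card e = 2" using assms unfolding finite_simple_graph_def by blast+
  then show thesis using that by (auto simp: card_2_iff)
qed

lemma finite_edges: "finite_simple_graph G \<Longrightarrow> finite (edges G)"
  by (rule finite_subset[of _ "Pow (verts G)"]) (auto simp: finite_simple_graph_def)

lemma avg_of_bool: "finite S \<Longrightarrow> avg S (\<lambda>x. of_bool (P x)) = real (card {x \<in> S. P x}) / real (card S)"
  by (simp add: avg_def Int_def)

text \<open>Quantifying over edges as sets, not over ordered pairs of endpoints, lets the edge set
  be built up one edge at a time.\<close>

lemma hom_density_eq_avg:
  assumes G: "finite_simple_graph G" and H: "finite_simple_graph H"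
  shows "hom_density G H
    = avg (verts G \<rightarrow>\<^sub>E verts H) (\<lambda>\<phi>. of_bool (\<forall>e\<in>edges G. \<phi> ` e \<in> edges H))"
proof -
  have "(\<forall>u v. {u, v} \<in> edges G \<longrightarrow> {\<phi> u, \<phi> v} \<in> edges H) \<longleftrightarrow> (\<forall>e\<in>edges G. \<phi> ` e \<in> edges H)"
    for \<phi>
  proof (intro iffI ballI allI impI)
    fix e assume *: "\<forall>u v. {u, v} \<in> edges G \<longrightarrow> {\<phi> u, \<phi> v} \<in> edges H" and e: "e \<in> edges G"
    obtain u v where "e = {u, v}" using edgeE[OF G e] .
    then show "\<phi> ` e \<in> edges H" using * e by simp
  next
    fix u v assume *: "\<forall>e\<in>edges G. \<phi> ` e \<in> edges H" and uv: "{u, v} \<in> edges G"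
    show "{\<phi> u, \<phi> v} \<in> edges H" using bspec[OF * uv] by simp
  qed
  moreover have "finite (verts G \<rightarrow>\<^sub>E verts H)"
    using G H by (simp add: finite_simple_graph_def finite_PiE)
  ultimately show ?thesis
    by (simp add: hom_density_def graph_homs_def avg_of_bool)
qed

text \<open>Isolates the images of the two endpoints of an edge while the images of all other
  vertices stay fixed.\<close>

lemma avg_PiE_two:
  assumes "u \<noteq> v" "u \<in> V" "v \<in> V"
  shows "avg (V \<rightarrow>\<^sub>E N) f
    = avg (V - {u, v} \<rightarrow>\<^sub>E N) (\<lambda>\<psi>. avg N (\<lambda>a. avg N (\<lambda>b. f (\<psi>(u := a, v := b)))))"
proof -
  have "V = insert v (insert u (V - {u, v}))" using assms by blast
  then have "avg (V \<rightarrow>\<^sub>E N) f = avg (insert v (insert u (V - {u, v})) \<rightarrow>\<^sub>E N) f" by simp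
  also have "\<dots> = avg (V - {u, v} \<rightarrow>\<^sub>E N) (\<lambda>\<psi>. avg N (\<lambda>a. avg N (\<lambda>b. f (\<psi>(u := a, v := b)))))"
    using assms by (simp add: avg_PiE_insert)
  finally show ?thesis .
qed

lemma hom_density_K2:
  assumes "finite_simple_graph H"
  shows "hom_density K2 H = avg (verts H) (\<lambda>a. avg (verts H) (adj H a))"
proof -
  have "hom_density K2 H
      = avg ({0, 1} \<rightarrow>\<^sub>E verts H) (\<lambda>\<phi> :: nat \<Rightarrow> 'a. of_bool ({\<phi> 0, \<phi> 1} \<in> edges H))"
    unfolding hom_density_eq_avg[OF finite_simple_graph_K2 assms] by (simp add: K2_def)
  also have "\<dots> = avg (verts H) (\<lambda>a. avg (verts H) (adj H a))"
    using avg_PiE_two[of 0 "1 :: nat" "{0, 1}" "verts H"]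
    by (simp add: avg_const adj_def[abs_def])
  finally show ?thesis .
qed

lemma hom_density_K2_eq_degr:
  "finite_simple_graph H \<Longrightarrow> hom_density K2 H = avg (verts H) (degr (verts H) (adj H))"
  unfolding degr_def by (subst avg_swap) (simp add: hom_density_K2)

section \<open>Four-cycles control all homomorphism densities\<close>

text \<open>Once the images of all vertices but \<open>u\<close> and \<open>v\<close> are fixed, the
  remaining edge conditions split into a function of \<open>a\<close> times a function of
  \<open>b\<close>, so \<open>bilinear_le_four_cycle\<close> bounds the cost of replacing the edge
  \<open>{u, v}\<close> by \<open>p\<close>.\<close>

lemma hom_density_insert_edge:
  assumes V: "finite V" and H: "finite_simple_graph H" "verts H \<noteq> {}"
    and uv: "u \<noteq> v" "u \<in> V" "v \<in> V" and F: "{u, v} \<notin> F" "\<And>e. e \<in> F \<Longrightarrow> card e = 2"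
  defines "t \<equiv> \<lambda>F. avg (V \<rightarrow>\<^sub>E verts H) (\<lambda>\<phi>. of_bool (\<forall>e\<in>F. \<phi> ` e \<in> edges H))"
  shows "\<bar>t (insert {u, v} F) - p * t F\<bar>
    \<le> root 4 (four_cycle (verts H) (\<lambda>a b. adj H a b - p))"
proof -
  let ?N = "verts H" and ?U = "\<lambda>a b. adj H a b - p"
  \<comment> \<open>Edges through \<open>v\<close> go into \<open>?g\<close>; all others, including
    those that miss both \<open>u\<close> and \<open>v\<close>, go into \<open>?f\<close>.\<close>
  let ?f = "\<lambda>\<psi> a. of_bool (\<forall>e\<in>F. v \<notin> e \<longrightarrow> \<psi>(u := a) ` e \<in> edges H) :: real"
  let ?g = "\<lambda>\<psi> b. of_bool (\<forall>e\<in>F. v \<in> e \<longrightarrow> \<psi>(v := b) ` e \<in> edges H) :: real"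
  have N: "finite ?N" using H by (simp add: finite_simple_graph_def)
  have X: "finite (V - {u, v} \<rightarrow>\<^sub>E ?N)" "(V - {u, v} \<rightarrow>\<^sub>E ?N) \<noteq> {}"
    using V N H(2) by (auto simp: finite_PiE PiE_eq_empty_iff)
  have split: "of_bool (\<forall>e\<in>F. (\<psi>(u := a, v := b)) ` e \<in> edges H) = ?f \<psi> a * ?g \<psi> b"
    for \<psi> a b
  proof -
    have 1: "(\<psi>(u := a, v := b)) ` e = \<psi>(u := a) ` e" if "v \<notin> e" for e
      using that by (intro image_cong) auto
    have 2: "(\<psi>(u := a, v := b)) ` e = \<psi>(v := b) ` e" if "e \<in> F" "v \<in> e" for e
    proof -
      \<comment> \<open>An edge of \<open>F\<close> through both endpoints would be
        \<open>{u, v}\<close> itself.\<close>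
      have "u \<notin> e" using that F(1) F(2)[OF that(1)] uv(1) by (auto simp: card_2_iff insert_commute)
      then show ?thesis by (intro image_cong) auto
    qed
    have "(\<forall>e\<in>F. (\<psi>(u := a, v := b)) ` e \<in> edges H) \<longleftrightarrow>
        (\<forall>e\<in>F. v \<notin> e \<longrightarrow> \<psi>(u := a) ` e \<in> edges H) \<and> (\<forall>e\<in>F. v \<in> e \<longrightarrow> \<psi>(v := b) ` e \<in> edges H)"
      using 1 2 by metis
    then show ?thesis by simp
  qed
  have "t (insert {u, v} F) - p * t F
      = avg (V \<rightarrow>\<^sub>E ?N) (\<lambda>\<phi>. ?U (\<phi> u) (\<phi> v) * of_bool (\<forall>e\<in>F. \<phi> ` e \<in> edges H))"
    unfolding t_def avg_cmult[symmetric] avg_diff[symmetric]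
    by (intro avg_cong) (auto simp: adj_def)
  also have "\<dots> = avg (V - {u, v} \<rightarrow>\<^sub>E ?N)
      (\<lambda>\<psi>. avg ?N (\<lambda>a. avg ?N (\<lambda>b. ?U a b * (?f \<psi> a * ?g \<psi> b))))"
    unfolding avg_PiE_two[OF uv] split using uv(1) by simp
  finally show ?thesis
    using avg_abs_le[OF X bilinear_le_four_cycle[OF N H(2)]] by simp
qed

text \<open>Induction over the edges of \<open>J\<close>: each replacement costs at most
  \<open>?r\<close>, and the factor \<open>p\<close> does not enlarge the error made so far.\<close>

lemma hom_density_near_power:
  assumes J: "finite_simple_graph J" and H: "finite_simple_graph H" "verts H \<noteq> {}"
    and p: "0 \<le> p" "p \<le> 1"
  shows "\<bar>hom_density J H - p ^ card (edges J)\<bar>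
    \<le> real (card (edges J)) * root 4 (four_cycle (verts H) (\<lambda>a b. adj H a b - p))"
proof -
  let ?r = "root 4 (four_cycle (verts H) (\<lambda>a b. adj H a b - p))"
  define t where
    "t F = avg (verts J \<rightarrow>\<^sub>E verts H) (\<lambda>\<phi>. of_bool (\<forall>e\<in>F. \<phi> ` e \<in> edges H))" for F
  have fin: "finite (verts J)" "finite (verts H)" using J H by (simp_all add: finite_simple_graph_def)
  have "F \<subseteq> edges J \<Longrightarrow> \<bar>t F - p ^ card F\<bar> \<le> real (card F) * ?r" if "finite F" for F
    using that
  proof (induction F rule: finite_induct)
    case empty
    have "finite (verts J \<rightarrow>\<^sub>E verts H)" "(verts J \<rightarrow>\<^sub>E verts H) \<noteq> {}"
      using fin H(2) by (auto simp: finite_PiE PiE_eq_empty_iff)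
    then show ?case by (simp add: t_def avg_const)
  next
    case (insert e F)
    then obtain u v where e: "e = {u, v}" "u \<noteq> v" "u \<in> verts J" "v \<in> verts J"
      using edgeE[OF J] by blast
    have "card e' = 2" if "e' \<in> F" for e'
      using that insert.prems J by (auto simp: finite_simple_graph_def)
    then have "\<bar>t (insert e F) - p * t F\<bar> \<le> ?r"
      using insert.hyps(2) unfolding e(1) t_def
      by (intro hom_density_insert_edge fin H e(2-4)) auto
    moreover have "\<bar>p * t F - p * p ^ card F\<bar> \<le> real (card F) * ?r"
    proof -
      have "\<bar>p * t F - p * p ^ card F\<bar> = p * \<bar>t F - p ^ card F\<bar>"
        using p by (simp add: right_diff_distrib[symmetric] abs_mult)
      also have "\<dots> \<le> \<bar>t F - p ^ card F\<bar>" using p by (simp add: mult_left_le_one_le)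
      also have "\<dots> \<le> real (card F) * ?r" using insert by simp
      finally show ?thesis .
    qed
    ultimately show ?case using insert.hyps by (simp add: algebra_simps)
  qed
  from this[OF finite_edges[OF J]] show ?thesis
    by (simp add: hom_density_eq_avg[OF J H(1)] t_def)
qed

text \<open>The mean squared degree lies between the square of the edge density and the square root
  of the four-cycle density, both tending to \<open>p\<^sup>2\<close>. Then
  \<open>four_cycle_diff_le\<close> sends the recentred four-cycle density to 0.\<close>

lemma quasi_random_if_four_cycle:
  fixes H :: "nat \<Rightarrow> 'b sgraph"
  assumes H: "increasing_graph_seq H" and p: "0 < p" "p \<le> 1"
    and D: "(\<lambda>n. hom_density K2 (H n)) \<longlonglongrightarrow> p"
    and C: "(\<lambda>n. four_cycle (verts (H n)) (adj (H n))) \<longlonglongrightarrow> p ^ 4"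
  shows "quasi_random p H"
proof -
  let ?N = "\<lambda>n. verts (H n)"
  define d2 where "d2 n = avg (?N n) (\<lambda>b. (degr (?N n) (adj (H n)) b)\<^sup>2)" for n
  define U where "U n = four_cycle (?N n) (\<lambda>a b. adj (H n) a b - p)" for n
  have Hn: "finite_simple_graph (H n)" "?N n \<noteq> {}" "finite (?N n)" for n
    using H by (simp_all add: increasing_graph_seq_def finite_simple_graph_def)
  have d2: "d2 \<longlonglongrightarrow> p\<^sup>2"
  proof (rule tendsto_sandwich)
    show "\<forall>\<^sub>F n in sequentially. (hom_density K2 (H n))\<^sup>2 \<le> d2 n"
      unfolding d2_def using avg_square_ge[OF Hn(3,2)]
      by (simp add: hom_density_K2_eq_degr[OF Hn(1)])
    show "\<forall>\<^sub>F n in sequentially. d2 n \<le> sqrt (four_cycle (?N n) (adj (H n)))"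
      unfolding d2_def using degr_square_le_four_cycle[OF Hn(3,2) adj_commute]
      by (intro always_eventually allI real_le_rsqrt)
    show "(\<lambda>n. (hom_density K2 (H n))\<^sup>2) \<longlonglongrightarrow> p\<^sup>2" using D by (rule tendsto_power)
    have "sqrt (p ^ 4) = p\<^sup>2" by (rule real_sqrt_unique) auto
    then show "(\<lambda>n. sqrt (four_cycle (?N n) (adj (H n)))) \<longlonglongrightarrow> p\<^sup>2"
      using tendsto_real_sqrt[OF C] by simp
  qed
  have "U \<longlonglongrightarrow> 0"
  proof (rule tendsto_sandwich[OF _ _ tendsto_const])
    let ?B = "\<lambda>n. 3 * ((four_cycle (?N n) (adj (H n)) - 2 * p\<^sup>2 * d2 n + p ^ 4)
      + 2 * p\<^sup>2 * (d2 n - 2 * p * hom_density K2 (H n) + p\<^sup>2))"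
    show "\<forall>\<^sub>F n in sequentially. 0 \<le> U n" by (simp add: U_def four_cycle_nonneg)
    show "\<forall>\<^sub>F n in sequentially. U n \<le> ?B n"
      unfolding U_def d2_def hom_density_K2_eq_degr[OF Hn(1)]
      by (intro always_eventually allI four_cycle_diff_le Hn(2,3) adj_commute)
    have "?B \<longlonglongrightarrow> 3 * ((p ^ 4 - 2 * p\<^sup>2 * p\<^sup>2 + p ^ 4) + 2 * p\<^sup>2 * (p\<^sup>2 - 2 * p * p + p\<^sup>2))"
      by (intro tendsto_intros C D d2)
    then show "?B \<longlonglongrightarrow> 0" by (simp add: power2_eq_square power4_eq_xxxx)
  qed
  then have r: "(\<lambda>n. root 4 (U n)) \<longlonglongrightarrow> 0" using tendsto_real_root[of U 0 _ 4] by simp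
  have "(\<lambda>n. hom_density J (H n)) \<longlonglongrightarrow> p ^ card (edges J)" if J: "finite_simple_graph J"
    for J :: "nat sgraph"
  proof -
    have "(\<lambda>n. hom_density J (H n) - p ^ card (edges J)) \<longlonglongrightarrow> 0"
    proof (rule tendsto_0_le[OF r])
      show "\<forall>\<^sub>F n in sequentially. norm (hom_density J (H n) - p ^ card (edges J))
          \<le> norm (root 4 (U n)) * real (card (edges J))"
        unfolding U_def using hom_density_near_power[OF J Hn(1,2)] p
        by (simp add: four_cycle_nonneg mult.commute)
    qed
    then show ?thesis by (rule LIM_zero_cancel)
  qed
  \<comment> \<open>Passing from convergence to asymptotic equivalence uses that the limit is
    nonzero, hence \<open>0 < p\<close>.\<close>
  then show ?thesis
    using H p by (auto simp: quasi_random_def intro!: tendsto_imp_asymp_equiv_const)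
qed

text \<open>The case \<open>p = 0\<close>, where asymptotic equivalence to 0 means being eventually
  equal to 0; a graph of edge density 0 has no edges.\<close>

lemma quasi_random_zero:
  fixes H :: "nat \<Rightarrow> 'b sgraph"
  assumes H: "increasing_graph_seq H" and D: "\<forall>\<^sub>F n in sequentially. hom_density K2 (H n) = 0"
  shows "quasi_random 0 H"
proof -
  have Hn: "finite_simple_graph (H n)" "verts (H n) \<noteq> {}" "finite (verts (H n))" for n
    using H by (simp_all add: increasing_graph_seq_def finite_simple_graph_def)
  have E: "edges (H n) = {}" if "hom_density K2 (H n) = 0" for n
  proof (rule ccontr)
    assume "edges (H n) \<noteq> {}"
    then obtain u v where uv: "{u, v} \<in> edges (H n)" "u \<in> verts (H n)" "v \<in> verts (H n)"
      using edgeE[OF Hn(1)] by (metis ex_in_conv)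
    have "(\<Sum>a\<in>verts (H n). \<Sum>b\<in>verts (H n). adj (H n) a b) = 0"
      using that Hn[of n]
      by (simp add: hom_density_K2 avg_def sum_divide_distrib[symmetric])
    then have "adj (H n) u v = 0"
      using uv Hn(3)[of n]
      by (subst (asm) sum_nonneg_eq_0_iff; force simp: sum_nonneg_eq_0_iff sum_nonneg adj_def)
    then show False using uv by (simp add: adj_def)
  qed
  \<comment> \<open>If \<open>J\<close> has no edges, both sides are 1; otherwise no map is a
    homomorphism.\<close>
  have "hom_density J (H n) = 0 ^ card (edges J)"
    if J: "finite_simple_graph J" and n: "hom_density K2 (H n) = 0" for J :: "nat sgraph" and n
  proof -
    have "finite (verts J \<rightarrow>\<^sub>E verts (H n))" "(verts J \<rightarrow>\<^sub>E verts (H n)) \<noteq> {}"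
      using J Hn by (auto simp: finite_PiE PiE_eq_empty_iff finite_simple_graph_def)
    then show ?thesis
      using finite_edges[OF J]
      by (cases "edges J = {}") (auto simp: hom_density_eq_avg[OF J Hn(1)] E[OF n] avg_const card_gt_0_iff)
  qed
  then show ?thesis
    using H D by (auto simp: quasi_random_def intro!: asymp_equiv_refl_ev elim!: eventually_mono)
qed

section \<open>Blow-ups\<close>

definition tuple_graph :: "nat \<Rightarrow> 'b sgraph \<Rightarrow> (nat \<Rightarrow> 'b) sgraph" where
  "tuple_graph m H =
     \<lparr>verts = {1..m} \<rightarrow>\<^sub>E verts H,
      edges = {{x, y} | x y. x \<in> {1..m} \<rightarrow>\<^sub>E verts H \<and> y \<in> {1..m} \<rightarrow>\<^sub>E verts H \<and>
        (\<forall>i\<in>{1..m}. \<forall>j\<in>{1..m}. {x i, y j} \<in> edges H)}\<rparr>"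

lemma verts_tuple_graph: "verts (tuple_graph m H) = {1..m} \<rightarrow>\<^sub>E verts H"
  by (simp add: tuple_graph_def)

text \<open>An edge determines its endpoints only up to order, but the condition is symmetric in
  \<open>x\<close> and \<open>y\<close>.\<close>

lemma edge_tuple_graph_iff:
  assumes "x \<in> {1..m} \<rightarrow>\<^sub>E verts H" "y \<in> {1..m} \<rightarrow>\<^sub>E verts H"
  shows "{x, y} \<in> edges (tuple_graph m H) \<longleftrightarrow> (\<forall>i\<in>{1..m}. \<forall>j\<in>{1..m}. {x i, y j} \<in> edges H)"
proof
  assume "{x, y} \<in> edges (tuple_graph m H)"
  then obtain x' y' where "{x, y} = {x', y'}"
    and *: "\<forall>i\<in>{1..m}. \<forall>j\<in>{1..m}. {x' i, y' j} \<in> edges H"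
    by (auto simp: tuple_graph_def)
  then have "x = x' \<and> y = y' \<or> x = y' \<and> y = x'" by (simp add: doubleton_eq_iff)
  then show "\<forall>i\<in>{1..m}. \<forall>j\<in>{1..m}. {x i, y j} \<in> edges H"
    using * by (auto simp: insert_commute)
next
  assume "\<forall>i\<in>{1..m}. \<forall>j\<in>{1..m}. {x i, y j} \<in> edges H"
  then show "{x, y} \<in> edges (tuple_graph m H)" using assms by (auto simp: tuple_graph_def)
qed

lemma edge_blow_up_iff:
  "{(v, i), (w, j)} \<in> edges (blow_up m G) \<longleftrightarrow> {v, w} \<in> edges G \<and> i \<in> {1..m} \<and> j \<in> {1..m}"
  unfolding blow_up_def by (auto simp: doubleton_eq_iff insert_commute)

text \<open>A loop at \<open>x\<close> would give a loop of \<open>H\<close> at \<open>x 1\<close>.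
  For \<open>m = 0\<close> there is no such coordinate and the empty tuple would carry a
  loop.\<close>

lemma finite_simple_graph_tuple_graph:
  assumes H: "finite_simple_graph H" and m: "m \<ge> 1"
  shows "finite_simple_graph (tuple_graph m H)"
proof -
  have "{a, a} \<notin> edges H" for a using H by (auto simp: finite_simple_graph_def)
  then have "x \<noteq> y" if "\<forall>i\<in>{1..m}. \<forall>j\<in>{1..m}. {x i, y j} \<in> edges H" for x y
    using that m by (metis atLeastAtMost_iff order_refl)
  then show ?thesis
    using H by (auto simp: finite_simple_graph_def tuple_graph_def finite_PiE)
qed

lemma card_edges_blow_up:
  assumes G: "finite_simple_graph G"
  shows "card (edges (blow_up m G)) = m * m * card (edges G)"
proof -
  \<comment> \<open>Fix an orientation of every edge, from \<open>s e\<close> to \<open>t e\<close>;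
    the edges of the blow-up over \<open>e\<close> are then indexed by pairs
    \<open>(i, j)\<close>.\<close>
  have "\<exists>u v. e = {u, v} \<and> u \<noteq> v" if "e \<in> edges G" for e
    using edgeE[OF G that] by blast
  then obtain s t where st: "\<And>e. e \<in> edges G \<Longrightarrow> e = {s e, t e} \<and> s e \<noteq> t e"
    by metis
  have "bij_betw (\<lambda>(e, i, j). {(s e, i), (t e, j)}) (edges G \<times> {1..m} \<times> {1..m}) (edges (blow_up m G))"
    unfolding bij_betw_def
  proof
    show "inj_on (\<lambda>(e, i, j). {(s e, i), (t e, j)}) (edges G \<times> {1..m} \<times> {1..m})"
    proof (rule inj_onI)
      fix x y assume xy: "x \<in> edges G \<times> {1..m} \<times> {1..m}" "y \<in> edges G \<times> {1..m} \<times> {1..m}"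
        "(\<lambda>(e, i, j). {(s e, i), (t e, j)}) x = (\<lambda>(e, i, j). {(s e, i), (t e, j)}) y"
      obtain e i j e' i' j' where x: "x = (e, i, j)" and y: "y = (e', i', j')"
        by (metis prod_cases3)
      have e: "e \<in> edges G" "e' \<in> edges G"
        and eq: "{(s e, i), (t e, j)} = {(s e', i'), (t e', j')}"
        using xy by (simp_all add: x y)
      \<comment> \<open>Projecting to \<open>G\<close> recovers the underlying edge.\<close>
      have "fst ` {(s e, i), (t e, j)} = fst ` {(s e', i'), (t e', j')}" using eq by simp
      then have "e = e'" using st[OF e(1)] st[OF e(2)] by simp
      then show "x = y" using eq st[OF e(1)] by (auto simp: doubleton_eq_iff x y)
    qed
    show "(\<lambda>(e, i, j). {(s e, i), (t e, j)}) ` (edges G \<times> {1..m} \<times> {1..m}) = edges (blow_up m G)"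
    proof (intro equalityI subsetI)
      fix x assume "x \<in> (\<lambda>(e, i, j). {(s e, i), (t e, j)}) ` (edges G \<times> {1..m} \<times> {1..m})"
      then show "x \<in> edges (blow_up m G)" using st by (auto simp: edge_blow_up_iff)
    next
      fix x assume "x \<in> edges (blow_up m G)"
      then obtain v w i j where x: "x = {(v, i), (w, j)}" "{v, w} \<in> edges G" "i \<in> {1..m}" "j \<in> {1..m}"
        unfolding blow_up_def by auto
      let ?e = "{v, w}"
      \<comment> \<open>The fixed orientation may be opposite to the given one, in which case
        \<open>i\<close> and \<open>j\<close> trade places.\<close>
      have "(s ?e = v \<and> t ?e = w) \<or> (s ?e = w \<and> t ?e = v)"
        using st[OF x(2)] by (auto simp: doubleton_eq_iff)
      then show "x \<in> (\<lambda>(e, i, j). {(s e, i), (t e, j)}) ` (edges G \<times> {1..m} \<times> {1..m})"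
      proof
        assume "s ?e = v \<and> t ?e = w"
        then show ?thesis using x by (intro image_eqI[of _ _ "(?e, i, j)"]) auto
      next
        assume "s ?e = w \<and> t ?e = v"
        then show ?thesis using x by (intro image_eqI[of _ _ "(?e, j, i)"]) auto
      qed
    qed
  qed
  then show ?thesis by (simp add: bij_betw_same_card[symmetric] card_cartesian_product)
qed

text \<open>Currying: the images of the \<open>m\<close> copies of a vertex of \<open>G\<close> form
  a single tuple.\<close>

lemma hom_density_blow_up:
  assumes G: "finite_simple_graph G"
  shows "hom_density (blow_up m G) H = hom_density G (tuple_graph m H)"
proof -
  let ?I = "{1..m}" and ?V = "verts G" and ?N = "verts H"
  define F where "F \<phi> = (\<lambda>v\<in>?V. \<lambda>i\<in>?I. \<phi> (v, i))" for \<phi> :: "'a \<times> nat \<Rightarrow> 'b"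
  have bij: "bij_betw F (?V \<times> ?I \<rightarrow>\<^sub>E ?N) (?V \<rightarrow>\<^sub>E (?I \<rightarrow>\<^sub>E ?N))"
  proof (rule bij_betwI[where g = "\<lambda>\<psi>. \<lambda>(v, i)\<in>?V \<times> ?I. \<psi> v i"])
    show "F \<in> (?V \<times> ?I \<rightarrow>\<^sub>E ?N) \<rightarrow> (?V \<rightarrow>\<^sub>E (?I \<rightarrow>\<^sub>E ?N))"
      by (auto simp: F_def)
    show "(\<lambda>\<psi>. \<lambda>(v, i)\<in>?V \<times> ?I. \<psi> v i) \<in> (?V \<rightarrow>\<^sub>E (?I \<rightarrow>\<^sub>E ?N)) \<rightarrow> (?V \<times> ?I \<rightarrow>\<^sub>E ?N)"
      by (fastforce simp: restrict_PiE_iff dest: PiE_mem)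
    show "(\<lambda>(v, i)\<in>?V \<times> ?I. F \<phi> v i) = \<phi>" if "\<phi> \<in> ?V \<times> ?I \<rightarrow>\<^sub>E ?N" for \<phi>
      using that by (auto simp: F_def fun_eq_iff PiE_iff extensional_def restrict_def)
    show "F (\<lambda>(v, i)\<in>?V \<times> ?I. \<psi> v i) = \<psi>" if "\<psi> \<in> ?V \<rightarrow>\<^sub>E (?I \<rightarrow>\<^sub>E ?N)" for \<psi>
      using that by (fastforce simp: F_def fun_eq_iff PiE_iff extensional_def restrict_def)
  qed
  have iff: "(\<forall>v w. {v, w} \<in> edges G \<longrightarrow> {F \<phi> v, F \<phi> w} \<in> edges (tuple_graph m H)) \<longleftrightarrow>
      (\<forall>x y. {x, y} \<in> edges (blow_up m G) \<longrightarrow> {\<phi> x, \<phi> y} \<in> edges H)"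
    if \<phi>: "\<phi> \<in> ?V \<times> ?I \<rightarrow>\<^sub>E ?N" for \<phi>
  proof -
    have "{F \<phi> v, F \<phi> w} \<in> edges (tuple_graph m H) \<longleftrightarrow>
        (\<forall>i\<in>?I. \<forall>j\<in>?I. {\<phi> (v, i), \<phi> (w, j)} \<in> edges H)" if vw: "{v, w} \<in> edges G" for v w
    proof -
      have "v \<in> ?V" "w \<in> ?V" using edge_vertsD[OF G vw] by auto
      moreover from this have "F \<phi> v \<in> ?I \<rightarrow>\<^sub>E ?N" "F \<phi> w \<in> ?I \<rightarrow>\<^sub>E ?N"
        using bij_betw_apply[OF bij \<phi>] by (auto dest: PiE_mem)
      ultimately show ?thesis by (simp add: edge_tuple_graph_iff) (simp add: F_def)
    qed
    then show ?thesis by (auto simp: split_paired_All edge_blow_up_iff)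
  qed
  have V: "verts (blow_up m G) = ?V \<times> ?I" by (simp add: blow_up_def)
  have "bij_betw F (graph_homs (blow_up m G) H) (graph_homs G (tuple_graph m H))"
    unfolding graph_homs_def verts_tuple_graph V
    by (rule bij_betw_Collect[OF bij]) (rule iff)
  \<comment> \<open>Currying also matches the sets of all maps, so the denominators agree.\<close>
  then show ?thesis
    using bij_betw_same_card[OF bij] by (simp add: hom_density_def bij_betw_same_card verts_tuple_graph V)
qed

text \<open>An edge of the tuple graph is a copy of the complete bipartite graph with both parts of
  size \<open>m\<close>, so \<open>complete_bipartite_ge_four_cycle\<close> applies.\<close>

lemma tuple_graph_density_ge:
  assumes H: "finite_simple_graph H" "verts H \<noteq> {}" and m: "m \<ge> 2"
  shows "root 4 (four_cycle (verts H) (adj H)) ^ (m * m) \<le> hom_density K2 (tuple_graph m H)"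
proof -
  let ?I = "{1..m}" and ?X = "{1..m} \<rightarrow>\<^sub>E verts H"
  have of_bool_prod: "(\<Prod>i\<in>S. of_bool (P i)) = (of_bool (\<forall>i\<in>S. P i) :: real)" if "finite S"
    for S :: "nat set" and P
    using that by (induction S rule: finite_induct) auto
  have "hom_density K2 (tuple_graph m H)
      = avg ?X (\<lambda>x. avg ?X (\<lambda>y. \<Prod>i\<in>?I. \<Prod>j\<in>?I. adj H (x i) (y j)))"
    using H m
    by (auto simp: hom_density_K2 finite_simple_graph_tuple_graph verts_tuple_graph adj_def
        edge_tuple_graph_iff of_bool_prod intro!: avg_cong)
  then show ?thesis
    using complete_bipartite_ge_four_cycle[of "verts H" ?I "adj H"] H m
    by (simp add: finite_simple_graph_def adj_def)
qed

text \<open>Cauchy-Schwarz twice: from the mean degree to the mean squared degree, then to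
  four-cycles.\<close>

lemma hom_density_K2_le_four_cycle:
  assumes H: "finite_simple_graph H" "verts H \<noteq> {}"
  shows "hom_density K2 H \<le> root 4 (four_cycle (verts H) (adj H))"
proof -
  let ?N = "verts H"
  let ?D = "avg ?N (\<lambda>b. (degr ?N (adj H) b)\<^sup>2)"
  have N: "finite ?N" using H by (simp add: finite_simple_graph_def)
  have D: "0 \<le> hom_density K2 H" by (simp add: hom_density_def)
  have "((hom_density K2 H)\<^sup>2)\<^sup>2 \<le> ?D\<^sup>2"
    unfolding hom_density_K2_eq_degr[OF H(1)] using N H(2)
    by (intro power_mono avg_square_ge) auto
  also have "\<dots> \<le> four_cycle ?N (adj H)"
    by (intro degr_square_le_four_cycle N H(2) adj_commute)
  finally have "root 4 (hom_density K2 H ^ 4) \<le> root 4 (four_cycle ?N (adj H))"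
    by (intro real_root_le_mono) auto
  then show ?thesis using real_root_power_cancel[of 4 "hom_density K2 H"] D by simp
qed

theorem theorem1p1:
  fixes G :: "'a sgraph" and m :: nat
  assumes "finite_simple_graph G"
    and "edges G \<noteq> {}"
    and "sidorenko G"
    and "m \<ge> 2"
  shows "forcing (blow_up m G)"
  unfolding forcing_def
proof (intro ballI allI impI, elim conjE)
  fix p :: real and H :: "nat \<Rightarrow> nat sgraph"
  assume p: "p \<in> {0..1}" and H: "increasing_graph_seq H"
    and K: "(\<lambda>n. hom_density K2 (H n)) \<sim>[sequentially] (\<lambda>n. p)"
    and B: "(\<lambda>n. hom_density (blow_up m G) (H n)) \<sim>[sequentially] (\<lambda>n. p ^ card (edges (blow_up m G)))"
  show "quasi_random p H"
  proof (cases "p = 0")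
    case True
    then show ?thesis using quasi_random_zero[OF H] K by (simp add: asymp_equiv_0_right_iff)
  next
    case False
    let ?M = "card (edges (blow_up m G))"
    let ?q = "\<lambda>n. root 4 (four_cycle (verts (H n)) (adj (H n)))"
    have Hn: "finite_simple_graph (H n)" "verts (H n) \<noteq> {}" for n
      using H by (simp_all add: increasing_graph_seq_def)
    \<comment> \<open>Positivity of the exponent allows \<open>?M\<close>-th roots to be taken
      below.\<close>
    have M: "?M > 0"
      using assms by (simp add: card_edges_blow_up card_gt_0_iff finite_edges)
    have q: "0 \<le> ?q n" for n by (simp add: four_cycle_nonneg)
    have D: "(\<lambda>n. hom_density K2 (H n)) \<longlonglongrightarrow> p" using K by (rule asymp_equivD_const)
    have "(\<lambda>n. ?q n ^ ?M) \<longlonglongrightarrow> p ^ ?M"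
    proof (rule tendsto_sandwich)
      show "\<forall>\<^sub>F n in sequentially. hom_density K2 (H n) ^ ?M \<le> ?q n ^ ?M"
        using hom_density_K2_le_four_cycle[OF Hn]
        by (intro always_eventually allI power_mono) (auto simp: hom_density_def)
      have "?q n ^ ?M \<le> hom_density (blow_up m G) (H n)" for n
      proof -
        have "?q n ^ ?M = (?q n ^ (m * m)) ^ card (edges G)"
          using assms by (simp add: card_edges_blow_up power_mult)
        also have "\<dots> \<le> hom_density K2 (tuple_graph m (H n)) ^ card (edges G)"
          using q by (intro power_mono tuple_graph_density_ge Hn assms) auto
        \<comment> \<open>The Sidorenko property is used for the host
          \<open>tuple_graph m (H n)\<close>, whose vertices are functions;
          \<open>sidorenkoD\<close> transfers it to this vertex type.\<close>
        also have "\<dots> \<le> hom_density G (tuple_graph m (H n))"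
          using assms Hn
          by (intro sidorenkoD finite_simple_graph_tuple_graph)
            (auto simp: verts_tuple_graph PiE_eq_empty_iff)
        finally show ?thesis by (simp add: hom_density_blow_up assms)
      qed
      then show "\<forall>\<^sub>F n in sequentially. ?q n ^ ?M \<le> hom_density (blow_up m G) (H n)" by simp
      show "(\<lambda>n. hom_density K2 (H n) ^ ?M) \<longlonglongrightarrow> p ^ ?M" using D by (rule tendsto_power)
      show "(\<lambda>n. hom_density (blow_up m G) (H n)) \<longlonglongrightarrow> p ^ ?M" using B by (rule asymp_equivD_const)
    qed
    \<comment> \<open>Since \<open>?q n\<close> and \<open>p\<close> are nonnegative, the root
      undoes the power on both sides.\<close>
    then have "(\<lambda>n. root ?M (?q n ^ ?M)) \<longlonglongrightarrow> root ?M (p ^ ?M)" by (rule tendsto_real_root)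
    then have "?q \<longlonglongrightarrow> p"
      using M p q by (simp add: real_root_power_cancel)
    then have "(\<lambda>n. ?q n ^ 4) \<longlonglongrightarrow> p ^ 4" by (rule tendsto_power)
    then have "(\<lambda>n. four_cycle (verts (H n)) (adj (H n))) \<longlonglongrightarrow> p ^ 4"
      by (simp add: four_cycle_nonneg)
    then show ?thesis using quasi_random_if_four_cycle[OF H _ _ D] p False by simp
  qed
qed

end
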